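(* Let $I\subset\mathbb{R}$ be an open interval, $\alpha<\beta$ with $[\alpha,\beta]\subset I$, $D\in C^1(I)$ and $f\in C^2(I)$. Suppose that $D(u)>0$ for every $u\in I\setminus\{\alpha,\beta\}$, that for some $m\ge 1$ $$D(s)\sim(s-\alpha)^m \ \text{ as } s\to\alpha^+,\qquad D(s)\sim(\beta-s)^m\ \text{ as } s\to\beta^-,$$ that $f(\alpha)=f(\beta)=0$, $f'(\alpha)>0$, $f'(\beta)>0$, and that $$\int_\alpha^\beta f(s)D(s)\,ds=0,\qquad \int_\alpha^u f(s)D(s)\,ds>0\quad\text{for all }u\in I,\ u\neq\alpha,\beta .$$ Then there exist constants $\bar x_1,\bar x_2>0$, independent of $\varepsilon$, such that for every $\varepsilon>0$, setting $x_1^\varepsilon:=-\varepsilon\bar x_1$ and $x_2^\varepsilon:=\varepsilon\bar x_2$, the following holds. The equation $$\varepsilon^2(D(\varphi)\varphi')'-f(\varphi)=0\qquad\text{on }\mathbb{R}$$ admits a solution $\Phi$ with $\Phi(0)=\frac{\alpha+\beta}{2}$ and $$\Phi(x)=\alpha \ \text{ for } x\le x_1^\varepsilon,\qquad \Phi(x)=\beta\ \text{ for } x\ge x_2^\varepsilon,\qquad \Phi'(x)>0\ \text{ for } x\in(x_1^\varepsilon,x_2^\varepsilon).$$ Similarly, the same equation admits a solution $\Psi$ with $\Psi(0)=\frac{\alpha+\beta}{2}$ and $$\Psi(x)=\beta \ \text{ for } x\le -x_2^\varepsilon,\qquad \Psi(x)=\alpha\ \text{ for } x\ge -x_1^\varepsilon,\qquad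 \Psi'(x)<0\ \text{ for } x\in(-x_2^\varepsilon,-x_1^\varepsilon).$$
   Context: Here $g_1(s)\sim g_2(s)$ as $s\to s_0$ means that $g_1(s)/g_2(s)$ tends to a finite, strictly positive limit. Since $D$ vanishes at $\alpha$ and $\beta$, the derivative of a solution may fail to exist at the points where the solution reaches $\alpha$ or $\beta$. A solution of $\varepsilon^2(D(\varphi)\varphi')'-f(\varphi)=0$ is understood as a continuous function $\varphi$ with values in $[\alpha,\beta]$ such that $K(\varphi)$ is $C^2$ and $\varepsilon^2 (K(\varphi))''=f(\varphi)$, where $K(u):=\int_\alpha^u D(s)\,ds$ (so that $(K(\varphi))'=D(\varphi)\varphi'$ wherever $\varphi$ is differentiable). *)

theory Defs
  imports "HOL-Analysis.Analysis"
begin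

definition C2_differentiable_on :: "(real \<Rightarrow> real) \<Rightarrow> real set \<Rightarrow> bool"
    (infix "C2'_differentiable'_on" 50)
  where "g C2_differentiable_on S \<longleftrightarrow>
    (\<exists>g'. (\<forall>x\<in>S. (g has_real_derivative g' x) (at x)) \<and> g' C1_differentiable_on S)"

text \<open>The relation \<open>g\<^sub>1 \<sim> g\<^sub>2\<close>: the limit of the quotient is only required to be finite and
  positive, unlike the library's asymptotic equivalence, which fixes it to be 1.\<close>

definition same_order :: "(real \<Rightarrow> real) \<Rightarrow> (real \<Rightarrow> real) \<Rightarrow> real filter \<Rightarrow> bool"
  where "same_order g\<^sub>1 g\<^sub>2 F \<longleftrightarrow> (\<exists>L>0. ((\<lambda>s. g\<^sub>1 s / g\<^sub>2 s) \<longlongrightarrow> L) F)"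

definition Kfun :: "(real \<Rightarrow> real) \<Rightarrow> real \<Rightarrow> real \<Rightarrow> real"
  where "Kfun D \<alpha> u = (LBINT s=ereal \<alpha>..ereal u. D s)"

text \<open>Solutions on the whole line of \<open>\<epsilon>\<^sup>2 (D(\<phi>) \<phi>')' - f(\<phi>) = 0\<close> with values in \<open>[\<alpha>, \<beta>]\<close>, in the
  sense \<open>\<epsilon>\<^sup>2 (K(\<phi>))'' = f(\<phi>)\<close>; \<open>\<phi>\<close> itself need not be differentiable where it reaches
  \<open>\<alpha>\<close> or \<open>\<beta>\<close>.\<close>

definition is_solution ::
    "real \<Rightarrow> (real \<Rightarrow> real) \<Rightarrow> (real \<Rightarrow> real) \<Rightarrow> real \<Rightarrow> real \<Rightarrow> (real \<Rightarrow> real) \<Rightarrow> bool"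
  where "is_solution \<epsilon> D f \<alpha> \<beta> \<phi> \<longleftrightarrow>
    continuous_on UNIV \<phi> \<and>
    (\<forall>x. \<phi> x \<in> {\<alpha>..\<beta>}) \<and>
    (\<lambda>x. Kfun D \<alpha> (\<phi> x)) C2_differentiable_on UNIV \<and>
    (\<forall>x. \<epsilon>\<^sup>2 * deriv (deriv (\<lambda>y. Kfun D \<alpha> (\<phi> y))) x - f (\<phi> x) = 0)"

end

theory Submission imports Defs begin

text \<open>Multiplying the equation by \<open>(K \<circ> \<phi>)' = D(\<phi>) \<phi>'\<close> and integrating once gives, for a
  front that starts at \<open>\<alpha>\<close> with zero flux and for \<open>\<epsilon> = 1\<close>, the first integral
  \<open>(D(\<phi>) \<phi>')\<^sup>2 = 2 G(\<phi>)\<close> with \<open>G(u) = \<integral>\<^sub>\<alpha>\<^sup>u f D\<close>. Since \<open>G > 0\<close> between \<open>\<alpha>\<close> and \<open>\<beta>\<close>, an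
  increasing front solves \<open>\<phi>' = sqrt (2 G(\<phi>)) / D(\<phi>)\<close>; that is, \<open>\<phi>\<close> is the inverse of the
  travel time \<open>T\<close>, an antiderivative of \<open>D / sqrt (2 G)\<close>.

  The degeneracy of \<open>D\<close> makes the front reach \<open>\<alpha>\<close> and \<open>\<beta>\<close> in finite time. Near \<open>\<alpha>\<close> the
  function \<open>f\<close> vanishes to first order and \<open>D\<close> to order \<open>m\<close>, so \<open>G\<close> vanishes to order
  \<open>m + 2\<close> and \<open>T'\<close> has order \<open>(u - \<alpha>)\<close> to the power \<open>m / 2 - 1\<close>, which is integrable because
  \<open>m > 0\<close> (\<open>travel_time_bounded_below\<close>; the end \<open>\<beta>\<close> follows by reflection, using
  \<open>G(\<beta>) = 0\<close>). Hence \<open>T\<close> extends continuously to \<open>[\<alpha>, \<beta>]\<close>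
  (\<open>increasing_extends_to_endpoints\<close>), and its inverse, continued by the constants \<open>\<alpha>\<close> and
  \<open>\<beta>\<close>, is a continuous function on the line (\<open>clamped_inverse\<close>).

  It remains to see that this function solves the equation also where it reaches \<open>\<alpha>\<close> and
  \<open>\<beta>\<close>. Off these two points \<open>(K \<circ> \<phi>)' = sqrt (2 G(\<phi>))\<close> and \<open>(K \<circ> \<phi>)'' = f(\<phi>)\<close>, and both
  right-hand sides are continuous on the whole line, so both identities extend across the two
  points (\<open>derivative_extends_across_finite_set\<close>). This is \<open>unit_profile_exists\<close>. The profile does
  not involve \<open>\<epsilon>\<close>: the fronts for general \<open>\<epsilon>\<close> are \<open>\<phi>(x / \<epsilon>)\<close> and \<open>\<phi>(- x / \<epsilon>)\<close>.\<close>


section \<open>Finite travel time to a degenerate end state\<close>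

lemma increasing_from_zero_limit_nonneg:
  fixes H H' :: "real \<Rightarrow> real"
  assumes H': "\<And>s. \<lbrakk>a < s; s < b\<rbrakk> \<Longrightarrow> (H has_real_derivative H' s) (at s)"
    and nonneg: "\<And>s. \<lbrakk>a < s; s < b\<rbrakk> \<Longrightarrow> H' s \<ge> 0"
    and lim: "(H \<longlongrightarrow> 0) (at_right a)"
    and s: "a < s" "s < b"
  shows "H s \<ge> 0"
proof (rule tendsto_upperbound[OF lim])
  have "eventually (\<lambda>x. x \<in> {a<..<s}) (at_right a)"
    using eventually_at_right_real[OF s(1)] .
  then show "eventually (\<lambda>x. H x \<le> H s) (at_right a)"
  proof eventually_elim
    case (elim x)
    show ?case
    proof (rule DERIV_nonneg_imp_nondecreasing[where f = H])
      fix y assume "x \<le> y" "y \<le> s"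
      then show "\<exists>d. (H has_real_derivative d) (at y) \<and> 0 \<le> d"
        using elim s by (intro exI[of _ "H' y"] conjI H' nonneg) auto
    qed (use elim in auto)
  qed
qed simp

text \<open>Near \<open>a\<close> the factor \<open>f\<close> is of order \<open>s - a\<close> and \<open>D\<close> of order \<open>(s - a) powr m\<close>, so
  \<open>G\<close> is bounded below by a multiple of \<open>(s - a) powr (m + 2)\<close>. The derivative of \<open>T\<close> is then
  dominated by a multiple of \<open>(s - a) powr (m / 2 - 1)\<close>, whose antiderivative
  \<open>(s - a) powr (m / 2)\<close> stays bounded. Comparing the two antiderivatives replaces the
  convergence of an improper integral.\<close>

lemma travel_time_bounded_below:
  fixes f D G T :: "real \<Rightarrow> real"
  assumes "a < c" and "m > 0"
    and f: "((\<lambda>s. f s / (s - a)) \<longlongrightarrow> l) (at_right a)" "l > 0"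
    and D: "((\<lambda>s. D s / (s - a) powr m) \<longlongrightarrow> L) (at_right a)" "L > 0"
    and G: "(G \<longlongrightarrow> 0) (at_right a)"
      "\<And>s. \<lbrakk>a < s; s < c\<rbrakk> \<Longrightarrow> (G has_real_derivative f s * D s) (at s)"
    and T: "\<And>s. \<lbrakk>a < s; s < c\<rbrakk> \<Longrightarrow> (T has_real_derivative D s / sqrt (2 * G s)) (at s)"
  shows "\<exists>B. eventually (\<lambda>u. B \<le> T u) (at_right a)"
proof -
  have "eventually (\<lambda>s. f s / (s - a) > l / 2) (at_right a)"
    using order_tendstoD(1)[OF f(1), of "l/2"] f(2) by simp
  moreover have "eventually (\<lambda>s. D s / (s - a) powr m > L / 2) (at_right a)"
    using order_tendstoD(1)[OF D(1), of "L/2"] D(2) by simp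
  moreover have "eventually (\<lambda>s. D s / (s - a) powr m < 2 * L) (at_right a)"
    using order_tendstoD(2)[OF D(1), of "2*L"] D(2) by simp
  ultimately have "eventually (\<lambda>s. f s / (s - a) > l / 2 \<and> D s / (s - a) powr m > L / 2
      \<and> D s / (s - a) powr m < 2 * L) (at_right a)"
    by (intro eventually_conj)
  then obtain b' where b': "b' > a" and near': "\<And>s. \<lbrakk>a < s; s < b'\<rbrakk> \<Longrightarrow> f s / (s - a) > l / 2 \<and>
      D s / (s - a) powr m > L / 2 \<and> D s / (s - a) powr m < 2 * L"
    unfolding eventually_at_right_field by blast
  define b where "b = min b' c"
  have ab: "a < b" "b \<le> c" using b' \<open>a < c\<close> by (auto simp: b_def)
  have near: "f s > l / 2 * (s - a)" "D s > L / 2 * (s - a) powr m" "D s < 2 * L * (s - a) powr m"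
    if "a < s" "s < b" for s
    using near'[of s] that by (auto simp: b_def field_simps)
  \<comment> \<open>The product of the lower bounds for \<open>f\<close> and \<open>D\<close> is \<open>l * L / 4\<close> times
    \<open>(s - a) powr (m + 1)\<close>; integrating it divides the constant by \<open>m + 2\<close>.\<close>
  define \<kappa> where "\<kappa> = l * L / (4 * (m + 2))"
  have \<kappa>: "\<kappa> > 0" using f D \<open>m > 0\<close> by (simp add: \<kappa>_def)
  have G_lower: "\<kappa> * (s - a) powr (m + 2) \<le> G s" if s: "a < s" "s < b" for s
  proof -
    have "G s - \<kappa> * (s - a) powr (m + 2) \<ge> 0"
    proof (rule increasing_from_zero_limit_nonneg[where a = a and b = b and s = s and
          H = "\<lambda>s. G s - \<kappa> * (s - a) powr (m + 2)" and
          H' = "\<lambda>s. f s * D s - \<kappa> * ((m + 2) * (s - a) powr (m + 1))"])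
      fix s assume s: "a < s" "s < b"
      show "((\<lambda>s. G s - \<kappa> * (s - a) powr (m + 2)) has_real_derivative
          f s * D s - \<kappa> * ((m + 2) * (s - a) powr (m + 1))) (at s)"
        using s ab by (auto intro!: derivative_eq_intros G simp: algebra_simps)
      have "\<kappa> * ((m + 2) * (s - a) powr (m + 1)) = (l / 2 * (s - a)) * (L / 2 * (s - a) powr m)"
        using s \<open>m > 0\<close> by (simp add: \<kappa>_def powr_add field_simps)
      also have "\<dots> \<le> f s * D s"
        using near[OF s] s f D
        by (intro mult_mono order_trans[OF _ less_imp_le[OF near(1)[OF s]]]) auto
      finally show "0 \<le> f s * D s - \<kappa> * ((m + 2) * (s - a) powr (m + 1))" by simp
    next
      have "((\<lambda>s. s - a) \<longlongrightarrow> 0) (at_right a)"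
        by (rule tendsto_eq_intros refl)+ simp
      then have "((\<lambda>s. (s - a) powr (m + 2)) \<longlongrightarrow> 0 powr (m + 2)) (at_right a)"
        using \<open>m > 0\<close>
        by (intro tendsto_powr2) (auto simp: eventually_at_right_field intro!: exI[of _ "a+1"])
      then have "((\<lambda>s. (s - a) powr (m + 2)) \<longlongrightarrow> 0) (at_right a)" by simp
      from tendsto_diff[OF G(1) tendsto_mult_right_zero[OF this, of \<kappa>]]
      show "((\<lambda>s. G s - \<kappa> * (s - a) powr (m + 2)) \<longlongrightarrow> 0) (at_right a)" by simp
    qed (use s in auto)
    then show ?thesis by simp
  qed
  define C where "C = 2 * L / sqrt (2 * \<kappa>)"
  have C: "C > 0" using D \<kappa> by (simp add: C_def)
  have speed: "D s / sqrt (2 * G s) \<le> C * (s - a) powr (m / 2 - 1)" if s: "a < s" "s < b" for s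
  proof -
    have sq: "sqrt (2 * (\<kappa> * (s - a) powr (m + 2))) = sqrt (2 * \<kappa>) * (s - a) powr (m / 2 + 1)"
      using s by (simp add: real_sqrt_mult powr_half_sqrt[symmetric] powr_powr add_divide_distrib)
    have "D s / sqrt (2 * G s) \<le> (2 * L * (s - a) powr m) / sqrt (2 * (\<kappa> * (s - a) powr (m + 2)))"
      using near[OF s] G_lower[OF s] s D \<kappa>
      by (intro frac_le) auto
    also have "\<dots> = C * ((s - a) powr m / (s - a) powr (m / 2 + 1))"
      unfolding sq C_def by simp
    also have "(s - a) powr m / (s - a) powr (m / 2 + 1) = (s - a) powr (m / 2 - 1)"
      by (simp add: powr_diff[symmetric])
    finally show ?thesis .
  qed
  \<comment> \<open>The comparison antiderivative minus \<open>T\<close>; it is nondecreasing by \<open>speed\<close>.\<close>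
  define W where "W s = C * (2 / m) * (s - a) powr (m / 2) - T s" for s
  define s0 where "s0 = (a + b) / 2"
  have s0: "a < s0" "s0 < b" using ab by (auto simp: s0_def)
  have W_mono: "W s \<le> W s0" if s: "a < s" "s < s0" for s
  proof (rule DERIV_nonneg_imp_nondecreasing[where f = W])
    fix y assume "s \<le> y" "y \<le> s0"
    then have y: "a < y" "y < b" using s s0 by auto
    have "(W has_real_derivative C * (y - a) powr (m / 2 - 1) - D y / sqrt (2 * G y)) (at y)"
      unfolding W_def using y ab \<open>m > 0\<close> by (auto intro!: derivative_eq_intros T)
    then show "\<exists>d. (W has_real_derivative d) (at y) \<and> 0 \<le> d"
      using speed[OF y] by force
  qed (use s in auto)
  have "- W s0 \<le> T s" if "s \<in> {a<..<s0}" for s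
  proof -
    have "0 \<le> C * (2 / m) * (s - a) powr (m / 2)" using C \<open>m > 0\<close> by simp
    then show ?thesis using W_mono[of s] that by (simp add: W_def)
  qed
  then show ?thesis
    using eventually_at_right_real[OF s0(1)] by (blast intro: eventually_mono)
qed

text \<open>The reflection \<open>s \<mapsto> - s\<close> turns this end into the one of \<open>travel_time_bounded_below\<close>: it
  changes the sign of \<open>f\<close> and of \<open>T\<close>, and leaves \<open>D\<close> and \<open>G\<close> as they are.\<close>

lemma travel_time_bounded_above:
  fixes f D G T :: "real \<Rightarrow> real"
  assumes "c < b" and "m > 0"
    and f: "((\<lambda>s. f s / (s - b)) \<longlongrightarrow> l) (at_left b)" "l > 0"
    and D: "((\<lambda>s. D s / (b - s) powr m) \<longlongrightarrow> L) (at_left b)" "L > 0"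
    and G: "(G \<longlongrightarrow> 0) (at_left b)"
      "\<And>s. \<lbrakk>c < s; s < b\<rbrakk> \<Longrightarrow> (G has_real_derivative f s * D s) (at s)"
    and T: "\<And>s. \<lbrakk>c < s; s < b\<rbrakk> \<Longrightarrow> (T has_real_derivative D s / sqrt (2 * G s)) (at s)"
  shows "\<exists>B. eventually (\<lambda>u. T u \<le> B) (at_left b)"
proof -
  have refl_deriv: "((\<lambda>x. g (- x)) has_real_derivative - d) (at s)"
    if "(g has_real_derivative d) (at (- s))" for g d and s :: real
    using DERIV_chain2[where f = g and g = uminus and Db = "-1" and x = s and s = UNIV, OF that]
      DERIV_minus[OF DERIV_ident, of s UNIV] by simp
  have "\<exists>B. eventually (\<lambda>u. B \<le> - T (- u)) (at_right (- b))"
  proof (rule travel_time_bounded_below[where c = "- c" and m = m and l = l and L = L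
        and f = "\<lambda>s. - f (- s)" and D = "\<lambda>s. D (- s)" and G = "\<lambda>s. G (- s)"])
    show "((\<lambda>s. - f (- s) / (s - - b)) \<longlongrightarrow> l) (at_right (- b))"
    proof -
      have "((\<lambda>s. f (- s) / (- s - b)) \<longlongrightarrow> l) (at_right (- b))"
        using f(1) unfolding at_left_minus[of b] filterlim_filtermap .
      moreover have "f (- s) / (- s - b) = - f (- s) / (s - - b)" for s
        using minus_divide_divide[of "f (- s)" "- s - b"] by (simp add: add.commute)
      ultimately show ?thesis by simp
    qed
    show "((\<lambda>s. D (- s) / (s - - b) powr m) \<longlongrightarrow> L) (at_right (- b))"
      using D(1) unfolding at_left_minus[of b] filterlim_filtermap by (simp add: add.commute)
    show "((\<lambda>s. G (- s)) \<longlongrightarrow> 0) (at_right (- b))"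
      using G(1) unfolding at_left_minus[of b] filterlim_filtermap .
    fix s assume "- b < s" "s < - c"
    then have s: "c < - s" "- s < b" by auto
    show "((\<lambda>s. G (- s)) has_real_derivative - f (- s) * D (- s)) (at s)"
      using refl_deriv[OF G(2)[OF s]] by simp
    show "((\<lambda>s. - T (- s)) has_real_derivative D (- s) / sqrt (2 * G (- s))) (at s)"
      using DERIV_minus[OF refl_deriv[OF T[OF s]]] by simp
  qed (use assms in auto)
  then obtain B where "eventually (\<lambda>u. B \<le> - T (- u)) (at_right (- b))" ..
  then have "eventually (\<lambda>u. T (- u) \<le> - B) (at_right (- b))"
    by eventually_elim simp
  then show ?thesis
    unfolding at_left_minus[of b] eventually_filtermap by blast
qed

section \<open>The continuous inverse of the travel time\<close>

lemma mono_bounded_below_has_limit: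
  fixes T :: "real \<Rightarrow> real"
  assumes "a < b" and mono: "\<And>x y. \<lbrakk>a < x; x \<le> y; y < b\<rbrakk> \<Longrightarrow> T x \<le> T y"
    and bdd: "eventually (\<lambda>u. B \<le> T u) (at_right a)"
  shows "\<exists>t. (T \<longlongrightarrow> t) (at_right a)"
proof -
  from bdd obtain b' where b': "b' > a" "\<And>u. \<lbrakk>a < u; u < b'\<rbrakk> \<Longrightarrow> B \<le> T u"
    unfolding eventually_at_right_field by blast
  have lower: "B \<le> T u" if "a < u" "u < b" for u
  proof -
    define v where "v = min u ((a + b') / 2)"
    have "a < v" "v < b'" "v \<le> u" using that b' by (auto simp: v_def min_def field_simps)
    then show ?thesis using b'(2)[of v] mono[of v u] that by linarith
  qed
  then have bb: "bdd_below (T ` {a<..<b})" by (auto intro!: bdd_belowI[of _ B])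
  have "(T \<longlongrightarrow> Inf (T ` {a<..<b})) (at_right a)"
  proof (rule order_tendstoI)
    fix y assume y: "y < Inf (T ` {a<..<b})"
    show "eventually (\<lambda>x. y < T x) (at_right a)"
      using eventually_at_right_real[OF \<open>a < b\<close>]
      by eventually_elim (rule less_le_trans[OF y cInf_lower[OF imageI bb]])
  next
    fix y assume "Inf (T ` {a<..<b}) < y"
    then obtain u where u: "a < u" "u < b" "T u < y"
      using cInf_lessD[of "T ` {a<..<b}" y] \<open>a < b\<close> by auto
    show "eventually (\<lambda>x. T x < y) (at_right a)"
      using eventually_at_right_real[OF u(1)]
      by eventually_elim (rule le_less_trans[OF mono u(3)], use u in auto)
  qed
  then show ?thesis ..
qed

lemma mono_bounded_above_has_limit:
  fixes T :: "real \<Rightarrow> real"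
  assumes "a < b" and mono: "\<And>x y. \<lbrakk>a < x; x \<le> y; y < b\<rbrakk> \<Longrightarrow> T x \<le> T y"
    and bdd: "eventually (\<lambda>u. T u \<le> B) (at_left b)"
  shows "\<exists>t. (T \<longlongrightarrow> t) (at_left b)"
proof -
  have "\<exists>t. ((\<lambda>u. - T (- u)) \<longlongrightarrow> t) (at_right (- b))"
  proof (rule mono_bounded_below_has_limit[of _ "- a" _ "- B"])
    show "eventually (\<lambda>u. - B \<le> - T (- u)) (at_right (- b))"
      using bdd unfolding at_left_minus[of b] eventually_filtermap by simp
  qed (use assms(1) mono in auto)
  then obtain t where "((\<lambda>u. - T (- u)) \<longlongrightarrow> t) (at_right (- b))" ..
  from tendsto_minus[OF this] have "(T \<longlongrightarrow> - t) (at_left b)"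
    unfolding at_left_minus[of b] filterlim_filtermap by simp
  then show ?thesis ..
qed

text \<open>A monotone function that is bounded near both ends has one-sided limits there; these serve
  as the values at the end points.\<close>

lemma increasing_extends_to_endpoints:
  fixes T g :: "real \<Rightarrow> real"
  assumes "a < b"
    and T: "\<And>s. \<lbrakk>a < s; s < b\<rbrakk> \<Longrightarrow> (T has_real_derivative g s) (at s)"
    and g: "\<And>s. \<lbrakk>a < s; s < b\<rbrakk> \<Longrightarrow> g s > 0"
    and below: "eventually (\<lambda>u. A \<le> T u) (at_right a)"
    and above: "eventually (\<lambda>u. T u \<le> B) (at_left b)"
  obtains S where "continuous_on {a..b} S"
    and "\<And>s. \<lbrakk>a < s; s < b\<rbrakk> \<Longrightarrow> S s = T s"
proof -
  have mono: "T x \<le> T y" if "a < x" "x \<le> y" "y < b" for x y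
  proof (rule DERIV_nonneg_imp_nondecreasing[where f = T])
    fix z assume "x \<le> z" "z \<le> y"
    then show "\<exists>d. (T has_real_derivative d) (at z) \<and> 0 \<le> d"
      using that T[of z] g[of z] by (intro exI[of _ "g z"]) auto
  qed fact
  obtain s t where s: "(T \<longlongrightarrow> s) (at_right a)" and t: "(T \<longlongrightarrow> t) (at_left b)"
    using mono_bounded_below_has_limit[OF \<open>a < b\<close> mono below]
      mono_bounded_above_has_limit[OF \<open>a < b\<close> mono above] by blast
  define S where "S u = (if u = a then s else if u = b then t else T u)" for u
  show thesis
  proof
    show "S u = T u" if "a < u" "u < b" for u using that by (simp add: S_def)
    show "continuous_on {a..b} S"
    proof (rule continuous_on_IccI)
      have "eventually (\<lambda>u. S u = T u) (at_right a)"
        using eventually_at_right_real[OF \<open>a < b\<close>] by eventually_elim (simp add: S_def)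
      then show "(S \<longlongrightarrow> S a) (at_right a)"
        using s by (subst tendsto_cong[of S T]) (auto simp: S_def)
      have "eventually (\<lambda>u. S u = T u) (at_left b)"
        using eventually_at_left_real[OF \<open>a < b\<close>] by eventually_elim (simp add: S_def)
      then show "(S \<longlongrightarrow> S b) (at_left b)"
        using t \<open>a < b\<close> by (subst tendsto_cong[of S T]) (auto simp: S_def)
      fix x assume x: "a < x" "x < b"
      have "eventually (\<lambda>u. u \<in> {a<..<b}) (at x)"
        using x by (intro eventually_at_in_open') auto
      then have "eventually (\<lambda>u. S u = T u) (at x)"
        by eventually_elim (simp add: S_def)
      moreover have "T \<midarrow>x\<rightarrow> T x" using DERIV_isCont[OF T[OF x]] by (simp add: isCont_def)
      ultimately show "S \<midarrow>x\<rightarrow> S x"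
        using x by (subst tendsto_cong[of S T]) (auto simp: S_def)
    qed fact
  qed
qed

text \<open>The inverse of an increasing continuous function on \<open>[a, b]\<close> is made total and continuous by
  projecting the argument to \<open>[S a, S b]\<close> first. The derivative at the end points is left open:
  \<open>g\<close> may tend to \<open>0\<close> or to infinity there.\<close>

lemma clamped_inverse:
  fixes S g :: "real \<Rightarrow> real"
  assumes "a < b" and cont: "continuous_on {a..b} S"
    and S: "\<And>s. \<lbrakk>a < s; s < b\<rbrakk> \<Longrightarrow> (S has_real_derivative g s) (at s)"
    and g: "\<And>s. \<lbrakk>a < s; s < b\<rbrakk> \<Longrightarrow> g s > 0"
  obtains \<phi> where "continuous_on UNIV \<phi>" and "strict_mono_on {a..b} S"
    and "\<And>u. u \<in> {a..b} \<Longrightarrow> \<phi> (S u) = u"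
    and "\<And>x. x \<le> S a \<Longrightarrow> \<phi> x = a" and "\<And>x. x \<ge> S b \<Longrightarrow> \<phi> x = b"
    and "\<And>x. \<lbrakk>S a < x; x < S b\<rbrakk> \<Longrightarrow> \<phi> x \<in> {a<..<b}"
    and "\<And>x. \<lbrakk>S a < x; x < S b\<rbrakk> \<Longrightarrow> (\<phi> has_real_derivative inverse (g (\<phi> x))) (at x)"
proof -
  have mono: "strict_mono_on {a..b} S"
  proof (rule strict_mono_onI)
    fix r s assume rs: "r \<in> {a..b}" "s \<in> {a..b}" "r < s"
    show "S r < S s"
    proof (rule DERIV_pos_imp_increasing_open[OF \<open>r < s\<close>])
      fix x assume "r < x" "x < s"
      then show "\<exists>y. (S has_real_derivative y) (at x) \<and> 0 < y"
        using rs by (intro exI[of _ "g x"] conjI S g) auto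
    qed (rule continuous_on_subset[OF cont], use rs in auto)
  qed
  have inj: "inj_on S {a..b}" using mono by (rule strict_mono_on_imp_inj_on)
  have Sab: "S a < S b" using mono \<open>a < b\<close> by (auto simp: strict_mono_on_def)
  have image: "S ` {a..b} = {S a..S b}"
  proof
    show "S ` {a..b} \<subseteq> {S a..S b}"
      using strict_mono_on_leD[OF mono] by auto
    show "{S a..S b} \<subseteq> S ` {a..b}"
      using IVT'[of S a _ b] cont \<open>a < b\<close> by (force simp: image_iff)
  qed
  define \<psi> where "\<psi> = inv_into {a..b} S"
  define clip where "clip x = max (S a) (min (S b) x)" for x
  define \<phi> where "\<phi> x = \<psi> (clip x)" for x
  have \<psi>S: "\<psi> (S u) = u" if "u \<in> {a..b}" for u
    unfolding \<psi>_def using inv_into_f_f[OF inj that] .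
  have S\<psi>: "S (\<psi> x) = x" "\<psi> x \<in> {a..b}" if "x \<in> {S a..S b}" for x
    using that unfolding \<psi>_def image[symmetric] by (auto intro: f_inv_into_f inv_into_into simp del: atLeastAtMost_iff)
  have "continuous_on (S ` {a..b}) \<psi>"
    by (rule continuous_on_inv[OF cont]) (auto simp: \<psi>S)
  moreover have "continuous_on UNIV clip" unfolding clip_def by (intro continuous_intros)
  ultimately have cont\<phi>: "continuous_on UNIV \<phi>"
    unfolding \<phi>_def image
    by (rule continuous_on_compose2) (use Sab in \<open>auto simp: clip_def\<close>)
  have inside: "clip x = x" if "S a \<le> x" "x \<le> S b" for x
    using that by (simp add: clip_def)
  have S\<phi>: "S (\<phi> x) = x" if "S a < x" "x < S b" for x
    using that S\<psi>(1)[of x] by (simp add: \<phi>_def inside)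
  have range: "\<phi> x \<in> {a<..<b}" if x: "S a < x" "x < S b" for x
  proof -
    have "\<phi> x \<in> {a..b}" using x S\<psi>(2)[of x] by (simp add: \<phi>_def inside)
    moreover have "\<phi> x \<noteq> a" "\<phi> x \<noteq> b" using S\<phi>[OF x] x by auto
    ultimately show ?thesis by auto
  qed
  show thesis
  proof
    show "(\<phi> has_real_derivative inverse (g (\<phi> x))) (at x)" if x: "S a < x" "x < S b" for x
    proof (rule DERIV_inverse_function[of S])
      show "(S has_real_derivative g (\<phi> x)) (at (\<phi> x))" using range[OF x] by (auto intro: S)
      show "g (\<phi> x) \<noteq> 0" using range[OF x] g[of "\<phi> x"] by auto
      show "isCont \<phi> x" using cont\<phi> by (simp add: continuous_on_eq_continuous_at)
    qed (use x S\<phi> in auto)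
    show "\<phi> x = a" if "x \<le> S a" for x
      using that Sab \<psi>S[of a] \<open>a < b\<close> by (simp add: \<phi>_def clip_def)
    show "\<phi> x = b" if "x \<ge> S b" for x
      using that Sab \<psi>S[of b] \<open>a < b\<close> by (simp add: \<phi>_def clip_def)
    show "\<phi> (S u) = u" if "u \<in> {a..b}" for u
    proof -
      have "S u \<in> {S a..S b}" unfolding image[symmetric] using that by (rule imageI)
      then show ?thesis using \<psi>S[OF that] by (simp add: \<phi>_def inside)
    qed
    show "\<phi> x \<in> {a<..<b}" if "S a < x" "x < S b" for x using range[OF that] .
  qed (rule cont\<phi> mono)+
qed

section \<open>The front\<close>

text \<open>The difference of \<open>F\<close> and an antiderivative of \<open>h\<close> is continuous and has derivative zero
  off a finite set, so it is constant.\<close>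

lemma derivative_extends_across_finite_set:
  fixes F h :: "real \<Rightarrow> real"
  assumes F: "continuous_on UNIV F" and h: "continuous_on UNIV h" and "finite N"
    and deriv: "\<And>x. x \<notin> N \<Longrightarrow> (F has_real_derivative h x) (at x)"
  shows "(F has_real_derivative h x) (at x)"
proof -
  obtain H where H: "\<And>x. (H has_real_derivative h x) (at x)"
    using einterval_antiderivative[of "- \<infinity>" \<infinity> h] h
    by (auto simp: continuous_on_eq_continuous_at has_real_derivative_iff_has_vector_derivative)
  have "F y - H y = F 0 - H 0" for y
  proof (rule has_derivative_zero_unique_strong_convex[of UNIV N "\<lambda>y. F y - H y" 0])
    show "continuous_on UNIV (\<lambda>y. F y - H y)"
      using H by (intro continuous_intros F) (meson DERIV_isCont continuous_at_imp_continuous_on)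
    fix x assume "x \<in> UNIV - N"
    then have "((\<lambda>y. F y - H y) has_real_derivative h x - h x) (at x)"
      by (intro DERIV_diff deriv H) auto
    then show "((\<lambda>y. F y - H y) has_derivative (\<lambda>h. 0)) (at x)"
      by (simp add: has_field_derivative_def lambda_zero)
  qed (use \<open>finite N\<close> in auto)
  then have "F = (\<lambda>y. H y + (F 0 - H 0))" by (auto simp: fun_eq_iff algebra_simps)
  moreover have "((\<lambda>y. H y + (F 0 - H 0)) has_real_derivative h x) (at x)"
    by (auto intro!: derivative_eq_intros H)
  ultimately show ?thesis by simp
qed

text \<open>The front for \<open>\<epsilon> = 1\<close>. The function \<open>h\<close> is the flux \<open>(K \<circ> \<phi>)'\<close>, which equals
  \<open>sqrt (2 G(\<phi>))\<close> by the first integral; so the last two conclusions together say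
  \<open>(K \<circ> \<phi>)'' = f(\<phi>)\<close>, including at \<open>t1\<close> and \<open>t2\<close>.\<close>

lemma unit_profile_exists:
  fixes D f G K T :: "real \<Rightarrow> real"
  assumes c: "a < c" "c < b"
    and f: "continuous_on {a..b} f" "f a = 0" "f b = 0"
    and D: "\<And>u. \<lbrakk>a < u; u < b\<rbrakk> \<Longrightarrow> D u > 0"
    and K: "continuous_on {a..b} K"
      "\<And>u. \<lbrakk>a < u; u < b\<rbrakk> \<Longrightarrow> (K has_real_derivative D u) (at u)"
    and G: "continuous_on {a..b} G" "G a = 0" "G b = 0"
      "\<And>u. \<lbrakk>a < u; u < b\<rbrakk> \<Longrightarrow> G u > 0"
      "\<And>u. \<lbrakk>a < u; u < b\<rbrakk> \<Longrightarrow> (G has_real_derivative f u * D u) (at u)"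
    and T: "\<And>u. \<lbrakk>a < u; u < b\<rbrakk> \<Longrightarrow> (T has_real_derivative D u / sqrt (2 * G u)) (at u)"
      "eventually (\<lambda>u. A \<le> T u) (at_right a)" "eventually (\<lambda>u. T u \<le> B) (at_left b)"
  obtains t1 t2 \<phi> h where "t1 < 0" "t2 > 0" "continuous_on UNIV \<phi>" "\<phi> 0 = c"
    and "\<And>x. \<phi> x \<in> {a..b}"
    and "\<And>x. x \<le> t1 \<Longrightarrow> \<phi> x = a" and "\<And>x. x \<ge> t2 \<Longrightarrow> \<phi> x = b"
    and "\<And>x. \<lbrakk>t1 < x; x < t2\<rbrakk> \<Longrightarrow> \<exists>d>0. (\<phi> has_real_derivative d) (at x)"
    and "\<And>x. ((\<lambda>x. K (\<phi> x)) has_real_derivative h x) (at x)"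
    and "\<And>x. (h has_real_derivative f (\<phi> x)) (at x)"
proof -
  have "a < b" using c by simp
  define g where "g u = D u / sqrt (2 * G u)" for u
  have g: "g u > 0" if "a < u" "u < b" for u
    using that D G by (simp add: g_def)
  have T': "(T has_real_derivative g u) (at u)" if "a < u" "u < b" for u
    using T(1)[OF that] by (simp add: g_def)
  obtain S where S: "continuous_on {a..b} S" "\<And>s. \<lbrakk>a < s; s < b\<rbrakk> \<Longrightarrow> S s = T s"
    using increasing_extends_to_endpoints[OF \<open>a < b\<close> T' g T(2,3)] by blast
  \<comment> \<open>The clock is set so that the profile passes through \<open>c\<close> at time \<open>0\<close>.\<close>
  define R where "R u = S u - S c" for u
  have contR: "continuous_on {a..b} R"
    unfolding R_def by (intro continuous_intros S)
  have R': "(R has_real_derivative g u) (at u)" if u: "a < u" "u < b" for u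
  proof -
    have "((\<lambda>u. T u - S c) has_real_derivative g u) (at u)"
      by (auto intro!: derivative_eq_intros T' u)
    then show ?thesis
      by (rule has_field_derivative_transform_within_open[where S = "{a<..<b}"])
        (use u S(2) in \<open>auto simp: R_def\<close>)
  qed
  obtain \<phi> where \<phi>: "continuous_on UNIV \<phi>" and mono: "strict_mono_on {a..b} R"
    and inv: "\<And>u. u \<in> {a..b} \<Longrightarrow> \<phi> (R u) = u"
    and left: "\<And>x. x \<le> R a \<Longrightarrow> \<phi> x = a" and right: "\<And>x. x \<ge> R b \<Longrightarrow> \<phi> x = b"
    and inside: "\<And>x. \<lbrakk>R a < x; x < R b\<rbrakk> \<Longrightarrow> \<phi> x \<in> {a<..<b}"
    and \<phi>': "\<And>x. \<lbrakk>R a < x; x < R b\<rbrakk> \<Longrightarrow> (\<phi> has_real_derivative inverse (g (\<phi> x))) (at x)"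
    using clamped_inverse[OF \<open>a < b\<close> contR R' g] by blast
  have "R c = 0" by (simp add: R_def)
  have range: "\<phi> x \<in> {a..b}" for x
    using left[of x] right[of x] inside[of x] \<open>a < b\<close>
    by (cases "x \<le> R a"; cases "x \<ge> R b") auto
  have cont_comp: "continuous_on UNIV (\<lambda>x. F (\<phi> x))" if "continuous_on {a..b} F" for F :: "real \<Rightarrow> real"
    by (rule continuous_on_compose2[OF that \<phi>]) (use range in auto)
  define h where "h x = sqrt (2 * G (\<phi> x))" for x
  have cont_h: "continuous_on UNIV h"
    unfolding h_def by (intro continuous_intros cont_comp G)
  \<comment> \<open>Outside \<open>[R a, R b]\<close> the profile is locally constant, and so is every function of it.\<close>
  have const: "((\<lambda>x. F (\<phi> x)) has_real_derivative 0) (at x)"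
    if "x < R a \<or> R b < x" for x and F :: "real \<Rightarrow> real"
    using that
  proof
    assume x: "x < R a"
    have "((\<lambda>x. F a) has_real_derivative 0) (at x)" by simp
    then show ?thesis
      by (rule has_field_derivative_transform_within_open[where S = "{..<R a}"])
        (use x left in auto)
  next
    assume x: "R b < x"
    have "((\<lambda>x. F b) has_real_derivative 0) (at x)" by simp
    then show ?thesis
      by (rule has_field_derivative_transform_within_open[where S = "{R b<..}"])
        (use x right in auto)
  qed
  have Kh: "((\<lambda>x. K (\<phi> x)) has_real_derivative h x) (at x)" for x
  proof (rule derivative_extends_across_finite_set[where N = "{R a, R b}"])
    fix x assume x: "x \<notin> {R a, R b}"
    show "((\<lambda>x. K (\<phi> x)) has_real_derivative h x) (at x)"
    proof (cases "R a < x \<and> x < R b")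
      case True
      then have i: "a < \<phi> x" "\<phi> x < b" using inside by auto
      have "((\<lambda>x. K (\<phi> x)) has_real_derivative D (\<phi> x) * inverse (g (\<phi> x))) (at x)"
        using True by (intro DERIV_chain2[where f = K] K i \<phi>') auto
      moreover have "D (\<phi> x) * inverse (g (\<phi> x)) = h x"
        using D[OF i] by (simp add: g_def h_def)
      ultimately show ?thesis by simp
    next
      case False
      then have out: "x < R a \<or> R b < x" using x by auto
      then have "h x = 0" using left[of x] right[of x] G by (auto simp: h_def)
      then show ?thesis using const[OF out, of K] by simp
    qed
  qed (use cont_comp K cont_h in auto)
  \<comment> \<open>Inside, \<open>(sqrt (2 G))' = f D / sqrt (2 G) = f g\<close>, and the factor \<open>g\<close> cancels against
    \<open>\<phi>' = 1 / g\<close>.\<close>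
  have hf: "(h has_real_derivative f (\<phi> x)) (at x)" for x
  proof (rule derivative_extends_across_finite_set[where N = "{R a, R b}"])
    fix x assume x: "x \<notin> {R a, R b}"
    show "(h has_real_derivative f (\<phi> x)) (at x)"
    proof (cases "R a < x \<and> x < R b")
      case True
      then have i: "a < \<phi> x" "\<phi> x < b" using inside by auto
      have "((\<lambda>u. sqrt (2 * G u)) has_real_derivative f (\<phi> x) * g (\<phi> x)) (at (\<phi> x))"
        using G(4)[OF i]
        by (auto intro!: derivative_eq_intros G i simp: g_def real_sqrt_mult field_simps)
      then have "(h has_real_derivative f (\<phi> x) * g (\<phi> x) * inverse (g (\<phi> x))) (at x)"
        unfolding h_def using True by (intro DERIV_chain2[where g = \<phi>] \<phi>') auto
      then show ?thesis using g[OF i] by (simp add: mult.assoc)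
    next
      case False
      then have out: "x < R a \<or> R b < x" using x by auto
      then have "f (\<phi> x) = 0" using left[of x] right[of x] f by auto
      then show ?thesis using const[OF out, of "\<lambda>u. sqrt (2 * G u)"] by (simp add: h_def[abs_def])
    qed
  qed (use cont_comp f cont_h in auto)
  show thesis
  proof
    show "R a < 0" "R b > 0"
      using mono c \<open>R c = 0\<close> strict_mono_onD[of "{a..b}" R a c] strict_mono_onD[of "{a..b}" R c b]
      by auto
    show "\<phi> 0 = c" using inv[of c] c \<open>R c = 0\<close> by simp
    show "\<exists>d>0. (\<phi> has_real_derivative d) (at x)" if "R a < x" "x < R b" for x
      using \<phi>'[OF that] inside[OF that] g by (intro exI[of _ "inverse (g (\<phi> x))"]) auto
    show "\<phi> x = a" if "x \<le> R a" for x using left[OF that] .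
    show "\<phi> x = b" if "R b \<le> x" for x using right[OF that] .
  qed (rule \<phi> range Kh hf)+
qed

text \<open>Both choices \<open>k = 1 / \<epsilon>\<close> and \<open>k = - 1 / \<epsilon>\<close> are covered, because only \<open>k\<^sup>2\<close> enters the
  equation: the sign gives the increasing and the decreasing front.\<close>

lemma rescaled_profile_is_solution:
  assumes \<phi>: "continuous_on UNIV \<phi>" and range: "\<And>x. \<phi> x \<in> {\<alpha>..\<beta>}"
    and K: "\<And>x. ((\<lambda>x. Kfun D \<alpha> (\<phi> x)) has_real_derivative h x) (at x)"
    and h: "\<And>x. (h has_real_derivative f (\<phi> x)) (at x)"
    and f: "continuous_on {\<alpha>..\<beta>} f"
    and k: "(\<epsilon> * k)\<^sup>2 = 1"
  shows "is_solution \<epsilon> D f \<alpha> \<beta> (\<lambda>x. \<phi> (k * x))"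
proof -
  have cont: "continuous_on UNIV (\<lambda>x. \<phi> (k * x))"
    by (rule continuous_on_compose2[OF \<phi>]) (auto intro: continuous_intros)
  have lin: "((\<lambda>x. k * x) has_real_derivative k) (at x)" for x
    by (auto intro!: derivative_eq_intros)
  have d1: "((\<lambda>x. Kfun D \<alpha> (\<phi> (k * x))) has_real_derivative h (k * x) * k) (at x)" for x
    using DERIV_chain2[OF K lin] .
  have d2: "((\<lambda>x. h (k * x) * k) has_real_derivative f (\<phi> (k * x)) * k * k) (at x)" for x
    using DERIV_cmult_right[OF DERIV_chain2[OF h lin]] .
  have "continuous_on UNIV (\<lambda>x. f (\<phi> (k * x)) * k * k)"
    by (intro continuous_intros continuous_on_compose2[OF f cont]) (use range in auto)
  then have "(\<lambda>x. h (k * x) * k) C1_differentiable_on UNIV"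
    unfolding C1_differentiable_on_def
    using d2 by (intro exI[of _ "\<lambda>x. f (\<phi> (k * x)) * k * k"])
      (simp add: has_real_derivative_iff_has_vector_derivative)
  then have C2: "(\<lambda>x. Kfun D \<alpha> (\<phi> (k * x))) C2_differentiable_on UNIV"
    unfolding C2_differentiable_on_def using d1
    by (intro exI[of _ "\<lambda>x. h (k * x) * k"] conjI ballI)
  have "deriv (\<lambda>x. Kfun D \<alpha> (\<phi> (k * x))) = (\<lambda>x. h (k * x) * k)"
    using DERIV_imp_deriv[OF d1] by blast
  then have "deriv (deriv (\<lambda>x. Kfun D \<alpha> (\<phi> (k * x)))) x = f (\<phi> (k * x)) * k * k" for x
    using DERIV_imp_deriv[OF d2] by simp
  moreover have "\<epsilon>\<^sup>2 * (f (\<phi> (k * x)) * k * k) = (\<epsilon> * k)\<^sup>2 * f (\<phi> (k * x))" for x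
    by (simp add: power2_eq_square)
  ultimately show ?thesis
    using cont C2 range k by (simp add: is_solution_def)
qed

section \<open>Application to the equation\<close>

lemma has_deriv_imp_quotient_tendsto:
  fixes f :: "real \<Rightarrow> real"
  assumes "(f has_real_derivative l) (at a)" "f a = 0"
  shows "((\<lambda>s. f s / (s - a)) \<longlongrightarrow> l) (at a within S)"
  using has_field_derivative_at_within[OF assms(1)] assms(2)
  by (simp add: has_field_derivative_iff)

lemma interval_integral_has_real_derivative:
  fixes F :: "real \<Rightarrow> real"
  assumes "continuous_on {a..b} F" "a \<le> u" "u \<le> b"
  shows "((\<lambda>u. LBINT s=ereal a..ereal u. F s) has_real_derivative F u) (at u within {a..b})"
  using interval_integral_FTC2[of a a b F u] assms
  by (simp add: has_real_derivative_iff_has_vector_derivative)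

lemma interval_integral_has_real_derivative_interior:
  fixes F :: "real \<Rightarrow> real"
  assumes "continuous_on {a..b} F" "a < u" "u < b"
  shows "((\<lambda>u. LBINT s=ereal a..ereal u. F s) has_real_derivative F u) (at u)"
  using interval_integral_has_real_derivative[OF assms(1), of u] assms(2,3)
  by (simp add: at_within_Icc_at)

lemma interval_integral_continuous:
  fixes F :: "real \<Rightarrow> real"
  assumes "continuous_on {a..b} F"
  shows "continuous_on {a..b} (\<lambda>u. LBINT s=ereal a..ereal u. F s)"
  by (rule DERIV_continuous_on, rule interval_integral_has_real_derivative[OF assms]) auto

theorem lemma2:
  fixes I :: "real set" and \<alpha> \<beta> m :: real and D f :: "real \<Rightarrow> real"
  assumes "open I" and "is_interval I"
    and "\<alpha> < \<beta>" and "{\<alpha>..\<beta>} \<subseteq> I"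
    and "D C1_differentiable_on I" and "f C2_differentiable_on I"
    and "\<forall>u\<in>I - {\<alpha>, \<beta>}. D u > 0"
    and "m \<ge> 1"
    and "same_order D (\<lambda>s. (s - \<alpha>) powr m) (at_right \<alpha>)"
    and "same_order D (\<lambda>s. (\<beta> - s) powr m) (at_left \<beta>)"
    and "f \<alpha> = 0" and "f \<beta> = 0"
    and "deriv f \<alpha> > 0" and "deriv f \<beta> > 0"
    and "(LBINT s=ereal \<alpha>..ereal \<beta>. f s * D s) = 0"
    and "\<forall>u\<in>I. u \<noteq> \<alpha> \<and> u \<noteq> \<beta> \<longrightarrow> (LBINT s=ereal \<alpha>..ereal u. f s * D s) > 0"
  shows "\<exists>xbar1 xbar2 :: real. xbar1 > 0 \<and> xbar2 > 0 \<and>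
    (\<forall>\<epsilon>>0. let x1 = - \<epsilon> * xbar1; x2 = \<epsilon> * xbar2 in
      (\<exists>\<Phi>. is_solution \<epsilon> D f \<alpha> \<beta> \<Phi> \<and> \<Phi> 0 = (\<alpha> + \<beta>) / 2 \<and>
        (\<forall>x\<le>x1. \<Phi> x = \<alpha>) \<and> (\<forall>x\<ge>x2. \<Phi> x = \<beta>) \<and>
        (\<forall>x\<in>{x1<..<x2}. \<exists>d>0. (\<Phi> has_real_derivative d) (at x))) \<and>
      (\<exists>\<Psi>. is_solution \<epsilon> D f \<alpha> \<beta> \<Psi> \<and> \<Psi> 0 = (\<alpha> + \<beta>) / 2 \<and>
        (\<forall>x\<le>- x2. \<Psi> x = \<beta>) \<and> (\<forall>x\<ge>- x1. \<Psi> x = \<alpha>) \<and>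
        (\<forall>x\<in>{- x2<..<- x1}. \<exists>d<0. (\<Psi> has_real_derivative d) (at x))))"
proof -
  define c where "c = (\<alpha> + \<beta>) / 2"
  have c: "\<alpha> < c" "c < \<beta>" using \<open>\<alpha> < \<beta>\<close> by (auto simp: c_def)
  have f': "(f has_real_derivative deriv f u) (at u)" if "u \<in> {\<alpha>..\<beta>}" for u
    using assms(4,6) that unfolding C2_differentiable_on_def by (metis DERIV_imp_deriv subsetD)
  have f_cont: "continuous_on {\<alpha>..\<beta>} f"
    by (rule DERIV_continuous_on) (rule has_field_derivative_at_within[OF f'])
  have D_cont: "continuous_on {\<alpha>..\<beta>} D"
    using C1_differentiable_imp_continuous_on[OF assms(5)] assms(4) continuous_on_subset by blast
  have fD_cont: "continuous_on {\<alpha>..\<beta>} (\<lambda>s. f s * D s)"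
    by (intro continuous_intros f_cont D_cont)
  have D_pos: "D u > 0" if "\<alpha> < u" "u < \<beta>" for u
    using that assms(4,7) by (auto simp: subset_iff)
  define G where "G u = (LBINT s=ereal \<alpha>..ereal u. f s * D s)" for u
  have G_cont: "continuous_on {\<alpha>..\<beta>} G"
    unfolding G_def by (rule interval_integral_continuous[OF fD_cont])
  have G': "(G has_real_derivative f u * D u) (at u)" if "\<alpha> < u" "u < \<beta>" for u
    unfolding G_def by (rule interval_integral_has_real_derivative_interior[OF fD_cont that])
  have G_ends: "G \<alpha> = 0" "G \<beta> = 0" using assms(15) by (auto simp: G_def)
  have G_pos: "G u > 0" if "\<alpha> < u" "u < \<beta>" for u
    using assms(4,16) that by (auto simp: G_def subset_iff)
  have K_cont: "continuous_on {\<alpha>..\<beta>} (Kfun D \<alpha>)"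
    unfolding Kfun_def by (rule interval_integral_continuous[OF D_cont])
  have K': "(Kfun D \<alpha> has_real_derivative D u) (at u)" if "\<alpha> < u" "u < \<beta>" for u
    unfolding Kfun_def by (rule interval_integral_has_real_derivative_interior[OF D_cont that])
  have "isCont (\<lambda>u. D u / sqrt (2 * G u)) u" if u: "\<alpha> < u" "u < \<beta>" for u
  proof -
    have "isCont D u" "isCont G u"
      using D_cont G_cont u
      by (auto intro: continuous_on_interior[of "{\<alpha>..\<beta>}"])
    then show ?thesis using G_pos[OF u] by (auto intro!: continuous_intros)
  qed
  then obtain T where T: "\<And>u. \<lbrakk>\<alpha> < u; u < \<beta>\<rbrakk> \<Longrightarrow> (T has_real_derivative D u / sqrt (2 * G u)) (at u)"
    using einterval_antiderivative[of "ereal \<alpha>" "ereal \<beta>" "\<lambda>u. D u / sqrt (2 * G u)"] \<open>\<alpha> < \<beta>\<close>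
    by (auto simp: has_real_derivative_iff_has_vector_derivative)
  have "(G \<longlongrightarrow> 0) (at_right \<alpha>)" "(G \<longlongrightarrow> 0) (at_left \<beta>)"
    using continuous_on_Icc_at_rightD[OF G_cont] continuous_on_Icc_at_leftD[OF G_cont]
      \<open>\<alpha> < \<beta>\<close> G_ends by auto
  note G_lim = this
  obtain L where L: "L > 0" "((\<lambda>s. D s / (s - \<alpha>) powr m) \<longlongrightarrow> L) (at_right \<alpha>)"
    using assms(9) by (auto simp: same_order_def)
  obtain M where M: "M > 0" "((\<lambda>s. D s / (\<beta> - s) powr m) \<longlongrightarrow> M) (at_left \<beta>)"
    using assms(10) by (auto simp: same_order_def)
  have "m > 0" using \<open>m \<ge> 1\<close> by simp
  have f_ends: "((\<lambda>s. f s / (s - \<alpha>)) \<longlongrightarrow> deriv f \<alpha>) (at_right \<alpha>)"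
    "((\<lambda>s. f s / (s - \<beta>)) \<longlongrightarrow> deriv f \<beta>) (at_left \<beta>)"
    using f' assms(11,12) \<open>\<alpha> < \<beta>\<close> by (auto intro!: has_deriv_imp_quotient_tendsto)
  have "\<exists>A. eventually (\<lambda>u. A \<le> T u) (at_right \<alpha>)"
    by (rule travel_time_bounded_below[OF \<open>\<alpha> < \<beta>\<close> \<open>m > 0\<close> f_ends(1) assms(13) L(2,1) G_lim(1)])
      (rule G' T; assumption)+
  then obtain A where A: "eventually (\<lambda>u. A \<le> T u) (at_right \<alpha>)" ..
  have "\<exists>B. eventually (\<lambda>u. T u \<le> B) (at_left \<beta>)"
    by (rule travel_time_bounded_above[OF \<open>\<alpha> < \<beta>\<close> \<open>m > 0\<close> f_ends(2) assms(14) M(2,1) G_lim(2)])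
      (rule G' T; assumption)+
  then obtain B where B: "eventually (\<lambda>u. T u \<le> B) (at_left \<beta>)" ..
  obtain t1 t2 \<phi> h where t: "t1 < 0" "t2 > 0" and \<phi>: "continuous_on UNIV \<phi>" "\<phi> 0 = c"
      "\<And>x. \<phi> x \<in> {\<alpha>..\<beta>}"
    and left: "\<And>x. x \<le> t1 \<Longrightarrow> \<phi> x = \<alpha>" and right: "\<And>x. x \<ge> t2 \<Longrightarrow> \<phi> x = \<beta>"
    and incr: "\<And>x. \<lbrakk>t1 < x; x < t2\<rbrakk> \<Longrightarrow> \<exists>d>0. (\<phi> has_real_derivative d) (at x)"
    and K\<phi>: "\<And>x. ((\<lambda>x. Kfun D \<alpha> (\<phi> x)) has_real_derivative h x) (at x)"
    and h: "\<And>x. (h has_real_derivative f (\<phi> x)) (at x)"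
    by (rule unit_profile_exists[OF c f_cont assms(11,12) _ K_cont _ G_cont G_ends _ _ _ A B])
      (rule D_pos K' G_pos G' T that; assumption)+
  note solution = rescaled_profile_is_solution[OF \<phi>(1,3) K\<phi> h f_cont]
  have scaled: "((\<lambda>x. \<phi> (k * x)) has_real_derivative d * k) (at x)"
    if "(\<phi> has_real_derivative d) (at (k * x))" for d k x
    by (rule DERIV_chain2[where f = \<phi> and g = "\<lambda>x. k * x", OF that]) (auto intro!: derivative_eq_intros)
  show ?thesis
  proof (intro exI conjI allI impI)
    show "- t1 > 0" "t2 > 0" using t by auto
    fix \<epsilon> :: real assume \<epsilon>: "\<epsilon> > 0"
    have "(\<exists>\<Phi>. is_solution \<epsilon> D f \<alpha> \<beta> \<Phi> \<and> \<Phi> 0 = c \<and>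
        (\<forall>x\<le>\<epsilon> * t1. \<Phi> x = \<alpha>) \<and> (\<forall>x\<ge>\<epsilon> * t2. \<Phi> x = \<beta>) \<and>
        (\<forall>x\<in>{\<epsilon> * t1<..<\<epsilon> * t2}. \<exists>d>0. (\<Phi> has_real_derivative d) (at x)))"
    proof (intro exI[of _ "\<lambda>x. \<phi> (1 / \<epsilon> * x)"] conjI allI impI ballI)
      show "is_solution \<epsilon> D f \<alpha> \<beta> (\<lambda>x. \<phi> (1 / \<epsilon> * x))" using \<epsilon> by (intro solution) simp
      show "\<phi> (1 / \<epsilon> * 0) = c" using \<phi>(2) by simp
      show "\<phi> (1 / \<epsilon> * x) = \<alpha>" if "x \<le> \<epsilon> * t1" for x
        using that \<epsilon> by (intro left) (simp add: field_simps)
      show "\<phi> (1 / \<epsilon> * x) = \<beta>" if "\<epsilon> * t2 \<le> x" for x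
        using that \<epsilon> by (intro right) (simp add: field_simps)
      fix x assume "x \<in> {\<epsilon> * t1<..<\<epsilon> * t2}"
      then obtain d where "d > 0" "(\<phi> has_real_derivative d) (at (1 / \<epsilon> * x))"
        using incr[of "1 / \<epsilon> * x"] \<epsilon> by (auto simp: field_simps)
      then show "\<exists>d>0. ((\<lambda>x. \<phi> (1 / \<epsilon> * x)) has_real_derivative d) (at x)"
        using scaled[of d "1 / \<epsilon>" x] \<epsilon> by (intro exI[of _ "d * (1 / \<epsilon>)"]) auto
    qed
    moreover have "(\<exists>\<Psi>. is_solution \<epsilon> D f \<alpha> \<beta> \<Psi> \<and> \<Psi> 0 = c \<and>
        (\<forall>x\<le>- (\<epsilon> * t2). \<Psi> x = \<beta>) \<and> (\<forall>x\<ge>- (\<epsilon> * t1). \<Psi> x = \<alpha>) \<and>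
        (\<forall>x\<in>{- (\<epsilon> * t2)<..<- (\<epsilon> * t1)}. \<exists>d<0. (\<Psi> has_real_derivative d) (at x)))"
    proof (intro exI[of _ "\<lambda>x. \<phi> (- 1 / \<epsilon> * x)"] conjI allI impI ballI)
      show "is_solution \<epsilon> D f \<alpha> \<beta> (\<lambda>x. \<phi> (- 1 / \<epsilon> * x))" using \<epsilon> by (intro solution) simp
      show "\<phi> (- 1 / \<epsilon> * 0) = c" using \<phi>(2) by simp
      show "\<phi> (- 1 / \<epsilon> * x) = \<beta>" if "x \<le> - (\<epsilon> * t2)" for x
        using that \<epsilon> by (intro right) (simp add: field_simps)
      show "\<phi> (- 1 / \<epsilon> * x) = \<alpha>" if "- (\<epsilon> * t1) \<le> x" for x
        using that \<epsilon> by (intro left) (simp add: field_simps)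
      fix x assume "x \<in> {- (\<epsilon> * t2)<..<- (\<epsilon> * t1)}"
      then obtain d where "d > 0" "(\<phi> has_real_derivative d) (at (- 1 / \<epsilon> * x))"
        using incr[of "- 1 / \<epsilon> * x"] \<epsilon> by (auto simp: field_simps)
      then show "\<exists>d<0. ((\<lambda>x. \<phi> (- 1 / \<epsilon> * x)) has_real_derivative d) (at x)"
        using scaled[of d "- 1 / \<epsilon>" x] \<epsilon> by (intro exI[of _ "d * (- 1 / \<epsilon>)"]) auto
    qed
    ultimately show "let x1 = - \<epsilon> * - t1; x2 = \<epsilon> * t2 in
      (\<exists>\<Phi>. is_solution \<epsilon> D f \<alpha> \<beta> \<Phi> \<and> \<Phi> 0 = (\<alpha> + \<beta>) / 2 \<and>
        (\<forall>x\<le>x1. \<Phi> x = \<alpha>) \<and> (\<forall>x\<ge>x2. \<Phi> x = \<beta>) \<and>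
        (\<forall>x\<in>{x1<..<x2}. \<exists>d>0. (\<Phi> has_real_derivative d) (at x))) \<and>
      (\<exists>\<Psi>. is_solution \<epsilon> D f \<alpha> \<beta> \<Psi> \<and> \<Psi> 0 = (\<alpha> + \<beta>) / 2 \<and>
        (\<forall>x\<le>- x2. \<Psi> x = \<beta>) \<and> (\<forall>x\<ge>- x1. \<Psi> x = \<alpha>) \<and>
        (\<forall>x\<in>{- x2<..<- x1}. \<exists>d<0. (\<Psi> has_real_derivative d) (at x)))"
      unfolding Let_def c_def by (simp only: minus_mult_minus simp_thms)
  qed
qed

end
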